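(* Let $p$ be an odd prime, let $m$ be a positive integer, let $h$ be a primitive of $\mathbb{Z}_p$, and let $z_\ell=\exp\left(2\pi i\frac{\ell}{p-1}\right)$ for $\ell=1,\dots,p-1$ (where $i=\sqrt{-1}$). Then $$\det A_{p,m}=\prod_{\ell=1}^{p-1}\left(\sum_{k=1}^{p-1}z_\ell^k\,(h^k\,(\mathbb{Z}_p))^m\right).$$
   Context: For an integer $a$ and an integer $p>1$, $a\,(\mathbb{Z}_p)$ denotes the remainder $r\in\{0,1,\dots,p-1\}$ of $a$ on division by $p$, regarded as an integer. For an odd prime $p$ and $1\le i\le p-1$, $i^{-1}$ denotes the multiplicative inverse of $i$ modulo $p$. For an odd prime $p$ and a positive integer $m$, $A_{p,m}$ is the $(p-1)\times(p-1)$ matrix $A_{p,m}=\left[(i^{-1}\cdot j\,(\mathbb{Z}_p))^m\right]_{i,j=1}^{p-1}$, where the outer exponentiation is taken in the integers. A nonzero element $h$ of $\mathbb{Z}_p$ is called primitive (a primitive of $\mathbb{Z}_p$) if $\{h^k\,(\mathbb{Z}_p):1\le k\le p-1\}=\{1,2,\dots,p-1\}$. *)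

theory Defs
  imports
    Complex_Main
    "HOL-Computational_Algebra.Primes"
    "HOL-Number_Theory.Modular_Inverse"
    "Jordan_Normal_Form.Determinant"
begin

text \<open>
  Matrix positions are counted from 0 in the library, so the entry at position \<open>(r, c)\<close> is the
  one with mathematical indices \<open>i = r + 1\<close> and \<open>j = c + 1\<close>.
  The remainder is an integer in \<open>{0..p-1}\<close>, and the outer power is taken in the integers.
\<close>

definition residue_power_mat :: "nat \<Rightarrow> nat \<Rightarrow> int mat" where
  "residue_power_mat p m =
     mat (p - 1) (p - 1)
       (\<lambda>(r, c). let i = int (r + 1); j = int (c + 1)
                 in ((modular_inverse (int p) i * j) mod int p) ^ m)"

text \<open>Elements of \<open>\<int>\<^sub>p\<close> are represented by the natural numbers below \<open>p\<close>.\<close>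

definition primitive_mod :: "nat \<Rightarrow> nat \<Rightarrow> bool" where
  "primitive_mod p h \<longleftrightarrow>
     h < p \<and> h \<noteq> 0 \<and> (\<lambda>k. h ^ k mod p) ` {1..p - 1} = {1..p - 1}"

end

theory Submission
  imports Defs "HOL-Number_Theory.Residues"
begin

text \<open>
  Once row \<open>i\<close> is labelled by the discrete logarithm \<open>e\<close> of \<open>i\<close> to the base \<open>h\<close>, the matrix is a
  circulant: its \<open>(i, j)\<close> entry depends only on \<open>e j - e i\<close> modulo \<open>p - 1\<close>. Hence the vectors
  \<open>(z\<^sub>l ^ e i)\<^sub>i\<close> are eigenvectors, with the factors of the product as eigenvalues, and they form a
  basis by orthogonality of the characters of \<open>\<int>/(p - 1)\<close>.
\<close>

text \<open>A geometric sum. The exponents run from 1 because discrete logarithms are taken in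
  \<open>{1..n}\<close> below; compared with \<open>k<n\<close> this only costs a factor
  \<open>x\<close>.\<close>

lemma sum_powers_root_of_unity:
  fixes x :: "'a :: field"
  assumes "x ^ n = 1" and "x \<noteq> 1"
  shows "(\<Sum>k = 1..n. x ^ k) = 0"
proof -
  have "(\<Sum>k = 1..n. x ^ k) = x * (\<Sum>k<n. x ^ k)"
    unfolding sum_distrib_left
    by (rule sum.reindex_bij_witness[of _ Suc "\<lambda>k. k - 1"]) (auto simp flip: power_Suc)
  also have "(\<Sum>k<n. x ^ k) = 0"
    using assms by (simp add: geometric_sum)
  finally show ?thesis by simp
qed

lemma det_diagonal_mat:
  fixes d :: "nat \<Rightarrow> 'a :: comm_ring_1"
  shows "det (mat n n (\<lambda>(i, j). if i = j then d i else 0)) = (\<Prod>i<n. d i)" (is "det ?D = _")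
proof -
  have "upper_triangular ?D" by (auto simp: upper_triangular_def)
  then have "det ?D = prod_list (diag_mat ?D)"
    by (rule det_upper_triangular[of _ n]) auto
  then show ?thesis by (simp add: prod_list_diag_prod lessThan_atLeast0)
qed

text \<open>The matrix is a Fourier matrix with permuted rows. Character orthogonality makes the
  matrix of inverse entries its inverse up to the factor \<open>n\<close>.\<close>

lemma det_root_of_unity_mat_nonzero:
  fixes z :: "nat \<Rightarrow> 'a :: field_char_0"
  assumes e: "bij_betw e {..<n} {1..n}"
    and z: "\<And>l. l < n \<Longrightarrow> z l ^ n = 1" "inj_on z {..<n}"
  shows "det (mat n n (\<lambda>(r, l). z l ^ e r)) \<noteq> 0" (is "det ?F \<noteq> 0")
proof
  let ?G = "mat n n (\<lambda>(l, r). inverse (z l) ^ e r)"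
  assume 0: "det ?F = 0"
  have "?G * ?F = mat n n (\<lambda>(i, j). if i = j then of_nat n else 0)"
  proof (rule eq_matI)
    fix i j assume "i < dim_row (mat n n (\<lambda>(i, j). if i = j then of_nat n else 0 :: 'a))"
      and "j < dim_col (mat n n (\<lambda>(i, j). if i = j then of_nat n else 0 :: 'a))"
    then have ij: "i < n" "j < n" by auto
    have nz: "z i \<noteq> 0" using z(1)[OF ij(1)] ij by (auto simp: power_0_left split: if_splits)
    have "(?G * ?F) $$ (i, j) = (\<Sum>r<n. (z j / z i) ^ e r)"
      using ij by (simp add: scalar_prod_def lessThan_atLeast0 power_divide field_simps)
    also have "\<dots> = (\<Sum>k = 1..n. (z j / z i) ^ k)"
      by (rule sum.reindex_bij_betw[OF e])
    also have "\<dots> = (if i = j then of_nat n else 0)"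
    proof (cases "i = j")
      case False
      then have "z j / z i \<noteq> 1" using z(2) ij nz by (auto simp: inj_on_def)
      moreover have "(z j / z i) ^ n = 1" using z(1) ij by (simp add: power_divide)
      ultimately show ?thesis using False sum_powers_root_of_unity by metis
    qed (use nz in simp)
    finally show "(?G * ?F) $$ (i, j)
        = mat n n (\<lambda>(i, j). if i = j then of_nat n else 0) $$ (i, j)"
      using ij by simp
  qed auto
  then have "det ?G * det ?F = of_nat n ^ n"
    using det_mult[of ?G n ?F] det_diagonal_mat[of n "\<lambda>_. of_nat n :: 'a"] by simp
  \<comment> \<open>For \<open>n > 0\<close> the right-hand side is nonzero by characteristic 0; for
    \<open>n = 0\<close> it is \<open>0 ^ 0 = 1\<close>.\<close>
  with 0 show False by auto
qed

text \<open>The columns of \<open>?F\<close> are eigenvectors, so \<open>A * ?F = ?F * ?D\<close>,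
  and the nonzero \<open>det ?F\<close> cancels. Stating \<open>entry\<close> as a congruence avoids
  truncated subtraction of labels.\<close>

lemma det_relabelled_circulant:
  fixes z c :: "nat \<Rightarrow> 'a :: field_char_0"
  assumes e: "bij_betw e {..<n} {1..n}"
    and z: "\<And>l. l < n \<Longrightarrow> z l ^ n = 1" "inj_on z {..<n}"
    and A: "A \<in> carrier_mat n n"
    and entry: "\<And>r s k. r < n \<Longrightarrow> s < n \<Longrightarrow> [e s = e r + k] (mod n) \<Longrightarrow> A $$ (r, s) = c k"
  shows "det A = (\<Prod>l<n. \<Sum>k = 1..n. z l ^ k * c k)"
proof -
  define d where "d = (\<lambda>l. \<Sum>k = 1..n. z l ^ k * c k)"
  let ?F = "mat n n (\<lambda>(r, l). z l ^ e r)"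
  let ?D = "mat n n (\<lambda>(i, j). if i = j then d i else 0)"
  have eigen: "(\<Sum>s<n. A $$ (r, s) * z l ^ e s) = z l ^ e r * d l" if "r < n" "l < n" for r l
  proof -
    \<comment> \<open>The representative of \<open>e r + k\<close> modulo \<open>n\<close> in
      \<open>{1..n}\<close>: the shift by 1 around \<open>mod\<close> sends multiples of
      \<open>n\<close> to \<open>n\<close> instead of 0.\<close>
    let ?f = "\<lambda>k. (e r + k - 1) mod n + 1"
    have "inj_on ?f {1..n}"
    proof (rule inj_onI)
      fix k k' assume k: "k \<in> {1..n}" "k' \<in> {1..n}" and "?f k = ?f k'"
      then have "[e r + (k - 1) = e r + (k' - 1)] (mod n)" by (auto simp: cong_def)
      then have "[k - 1 = k' - 1] (mod n)" by (simp only: cong_add_lcancel_nat)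
      then have "k - 1 = k' - 1"
        using k by (intro cong_less_modulus_unique_nat[of _ _ n]) auto
      with k show "k = k'" by auto
    qed
    moreover have "?f ` {1..n} \<subseteq> {1..n}" using \<open>r < n\<close> by (auto simp: Suc_le_eq)
    ultimately have f: "bij_betw ?f {1..n} {1..n}"
      by (simp add: bij_betw_def endo_inj_surj)
    \<comment> \<open>\<open>g k\<close> is the column whose label exceeds that of row
      \<open>r\<close> by \<open>k\<close> modulo \<open>n\<close>, so row \<open>r\<close> can be
      summed by label difference.\<close>
    define g where "g = inv_into {..<n} e \<circ> ?f"
    have g: "bij_betw g {1..n} {..<n}"
      unfolding g_def by (rule bij_betw_trans[OF f bij_betw_inv_into[OF e]])
    have eg: "[e (g k) = e r + k] (mod n)" if "k \<in> {1..n}" for k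
    proof -
      have "?f k \<in> e ` {..<n}" using f e that by (auto simp: bij_betw_def)
      then have "e (g k) = (e r + k - 1) mod n + 1" by (simp add: g_def f_inv_into_f)
      moreover have "[(e r + k - 1) mod n + 1 = e r + k - 1 + 1] (mod n)"
        by (intro cong_add) (auto simp: cong_def)
      ultimately show ?thesis using that by simp
    qed
    have zcong: "z l ^ a = z l ^ b" if "[a = b] (mod n)" for a b
    proof -
      have "z l ^ a = z l ^ (a mod n)" for a
        using z(1)[OF \<open>l < n\<close>] mult_div_mod_eq[of n a]
        by (metis mult_1 power_add power_mult power_one)
      then show ?thesis using that by (metis cong_def)
    qed
    have "(\<Sum>s<n. A $$ (r, s) * z l ^ e s) = (\<Sum>k = 1..n. A $$ (r, g k) * z l ^ e (g k))"
      by (rule sum.reindex_bij_betw[OF g, symmetric])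
    also have "\<dots> = (\<Sum>k = 1..n. c k * z l ^ (e r + k))"
    proof (rule sum.cong[OF refl])
      fix k assume k: "k \<in> {1..n}"
      then have "g k < n" using g by (auto simp: bij_betw_def)
      then show "A $$ (r, g k) * z l ^ e (g k) = c k * z l ^ (e r + k)"
        using entry[OF \<open>r < n\<close> _ eg[OF k]] zcong[OF eg[OF k]] by simp
    qed
    also have "\<dots> = z l ^ e r * d l"
      by (simp add: d_def sum_distrib_left power_add mult_ac)
    finally show ?thesis .
  qed
  have "A * ?F = ?F * ?D"
  proof (rule eq_matI)
    fix r l assume "r < dim_row (?F * ?D)" and "l < dim_col (?F * ?D)"
    then have rl: "r < n" "l < n" by auto
    then have "(A * ?F) $$ (r, l) = (\<Sum>s<n. A $$ (r, s) * z l ^ e s)"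
      using A by (simp add: scalar_prod_def lessThan_atLeast0)
    \<comment> \<open>A sum with a single nonzero term has the shape of an entry of
      \<open>?F * ?D\<close>, so the two can be compared termwise.\<close>
    also have "\<dots> = (\<Sum>s<n. if s = l then z l ^ e r * d l else 0)"
      using rl by (simp add: eigen)
    also have "\<dots> = (?F * ?D) $$ (r, l)"
      using rl by (auto simp: scalar_prod_def lessThan_atLeast0 simp del: sum.delta
          intro!: sum.cong)
    finally show "(A * ?F) $$ (r, l) = (?F * ?D) $$ (r, l)" .
  qed (use A in auto)
  moreover have "det (A * ?F) = det A * det ?F"
    by (rule det_mult[OF A]) simp
  moreover have "det (?F * ?D) = det ?F * det ?D"
    by (rule det_mult[of _ n]) simp_all
  ultimately have "det ?F * det A = det ?F * det ?D"
    by (simp only: mult.commute[of "det A"])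
  then have "det A = det ?D"
    using det_root_of_unity_mat_nonzero[OF e z] by simp
  then show ?thesis by (simp add: det_diagonal_mat d_def)
qed

theorem corollary2p9:
  fixes p m h :: nat and z :: "nat \<Rightarrow> complex"
  assumes "prime p" and "odd p"
    and "m > 0"
    and "primitive_mod p h"
    and "\<And>l. l \<in> {1..p - 1} \<Longrightarrow>
           z l = exp (2 * of_real pi * \<i> * (of_nat l / of_nat (p - 1)))"
  shows "(of_int (det (residue_power_mat p m)) :: complex) =
           (\<Prod>l = 1..p - 1. \<Sum>k = 1..p - 1. z l ^ k * of_nat ((h ^ k mod p) ^ m))"
proof -
  define n where "n = p - 1"
  have p: "p = Suc n" and "n \<ge> 1"
    using prime_gt_1_nat[OF assms(1)] by (auto simp: n_def)
  let ?G = "\<lambda>k. h ^ k mod p"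
  \<comment> \<open>The eigenvectors involve roots of unity, so the integer matrix is moved to the
    complex numbers.\<close>
  let ?A = "map_mat (of_int :: int \<Rightarrow> complex) (residue_power_mat p m)"
  have h: "h < p" "h \<noteq> 0" and surj: "?G ` {1..n} = {1..n}"
    using assms(4) by (auto simp: primitive_mod_def n_def)
  have "inj_on ?G {1..n}" using surj by (simp add: eq_card_imp_inj_on)
  with surj have G: "bij_betw ?G {1..n} {1..n}" by (simp add: bij_betw_def)
  \<comment> \<open>The discrete logarithm to base \<open>h\<close>; \<open>Suc\<close> turns a row
    position into the residue it stands for.\<close>
  define e where "e = inv_into {1..n} ?G \<circ> Suc"
  have e: "bij_betw e {..<n} {1..n}"
    unfolding e_def using bij_betw_inv_into[OF G]
    by (rule bij_betw_trans[rotated]) (simp add: bij_betw_def image_Suc_lessThan)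
  have Ge: "?G (e r) = Suc r" if "r < n" for r
    
  proof -
    have "Suc r \<in> ?G ` {1..n}" using that unfolding surj by simp
    then show ?thesis unfolding e_def o_def by (rule f_inv_into_f)
  qed
  \<comment> \<open>This makes powers of \<open>h\<close> modulo \<open>p\<close> depend only on the
    exponent modulo \<open>n\<close>.\<close>
  have fermat: "[h ^ n = 1] (mod p)"
    unfolding n_def using assms(1) h by (intro fermat_theorem) (auto dest: dvd_imp_le)
  have hpow: "[h ^ a = h ^ b] (mod p)" if "[a = b] (mod n)" for a b
  proof -
    have "[h ^ a = h ^ (a mod n)] (mod p)" for a
    proof -
      have "[(h ^ n) ^ (a div n) * h ^ (a mod n) = 1 ^ (a div n) * h ^ (a mod n)] (mod p)"
        by (intro cong_mult cong_pow fermat cong_refl)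
      then show ?thesis by (simp flip: power_mult power_add)
    qed
    then show ?thesis using that by (metis cong_def)
  qed
  \<comment> \<open>The library enumerates the \<open>n\<close>-th roots of unity from index 0.
    Passing to \<open>z (Suc l)\<close> multiplies each by one fixed root, which keeps them distinct
    \<open>n\<close>-th roots.\<close>
  let ?w = "\<lambda>l. cis (2 * pi * real l / real n)"
  have roots: "bij_betw ?w {..<n} {x. x ^ n = 1}"
    using \<open>n \<ge> 1\<close> by (intro bij_betw_roots_unity) simp
  have zw: "z (Suc l) = cis (2 * pi / real n) * ?w l" if "l < n" for l
    using assms(5)[of "Suc l"] that
    by (simp add: n_def cis_mult cis_conv_exp add_divide_distrib distrib_left mult_ac exp_add)
  have "det ?A = (\<Prod>l<n. \<Sum>k = 1..n. z (Suc l) ^ k * of_nat ((h ^ k mod p) ^ m))"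
  proof (rule det_relabelled_circulant[OF e])
    fix l assume "l < n"
    then show "z (Suc l) ^ n = 1"
      using roots zw by (auto simp: bij_betw_def power_mult_distrib DeMoivre)
  next
    show "inj_on (\<lambda>l. z (Suc l)) {..<n}"
      using roots zw by (auto simp: bij_betw_def inj_on_def)
  next
    show "?A \<in> carrier_mat n n" by (simp add: residue_power_mat_def n_def)
  next
    fix r s k assume r: "r < n" and s: "s < n" and "[e s = e r + k] (mod n)"
    then have "[h ^ e s = h ^ e r * h ^ k] (mod p)"
      by (auto dest: hpow simp: power_add)
    then have "[Suc s = Suc r * h ^ k] (mod p)"
      using Ge[OF r] Ge[OF s] by (metis cong_def mod_mult_left_eq mod_mod_trivial)
    then have "[int (Suc s) = int (Suc r) * int (h ^ k)] (mod int p)"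
      by (metis cong_int_iff of_nat_mult)
    \<comment> \<open>Multiplying by the inverse of the row residue isolates \<open>h ^ k\<close>,
      and the left side becomes the matrix entry before reduction and powering.\<close>
    then have "[modular_inverse (int p) (int (Suc r)) * int (Suc s)
        = modular_inverse (int p) (int (Suc r)) * (int (Suc r) * int (h ^ k))] (mod int p)"
      by (rule cong_mult[OF cong_refl])
    also have "modular_inverse (int p) (int (Suc r)) * (int (Suc r) * int (h ^ k))
        = (modular_inverse (int p) (int (Suc r)) * int (Suc r)) * int (h ^ k)"
      by (simp only: mult.assoc)
    also have "[\<dots> = 1 * int (h ^ k)] (mod int p)"
    proof (intro cong_mult cong_refl)
      \<comment> \<open>The residue is invertible since \<open>0 < Suc r < p\<close> and
        \<open>p\<close> is prime.\<close>
      have "coprime p (Suc r)"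
        using assms(1) r p by (intro prime_imp_coprime) (auto dest: dvd_imp_le)
      then have "coprime (int (Suc r)) (int p)"
        by (metis coprime_int_iff coprime_commute)
      then show "[modular_inverse (int p) (int (Suc r)) * int (Suc r) = 1] (mod int p)"
        by (rule cong_modular_inverse2)
    qed
    finally have "modular_inverse (int p) (int (Suc r)) * int (Suc s) mod int p
        = int (h ^ k mod p)"
      by (simp add: cong_def zmod_int)
    then show "?A $$ (r, s) = of_nat ((h ^ k mod p) ^ m)"
      using r s by (simp add: residue_power_mat_def Let_def p flip: of_nat_power)
  qed
  also have "det ?A = of_int (det (residue_power_mat p m))"
    by (rule of_int_hom.hom_det)
  finally show ?thesis
    by (simp add: n_def prod.shift_bounds_Suc_ivl lessThan_atLeast0 prod.atLeast1_atMost_eq)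
qed

end
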